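(* The identities $(x^* )^*\approx x$, $(xy)^*\approx y^*x^*$, together with the following identities and the reverses of the following identities, constitute an identity basis for $(\mathsf{baxt}_2,{}^{\sharp})$: \begin{align*} &x^*hxk\,xy\,sx^*tx\approx x^*hxk\,yx\,sx^*tx, && x^*hxk\,xy\,sxtx^*\approx x^*hxk\,yx\,sxtx^*,\\ &xhx^*k\,xy\,sx^*tx\approx xhx^*k\,yx\,sx^*tx, && xhx^*k\,xy\,sxtx^*\approx xhx^*k\,yx\,sxtx^*,\\ &x^*hxk\,xy\,sy^*ty\approx x^*hxk\,yx\,sy^*ty, && x^*hxk\,xy\,syty^*\approx x^*hxk\,yx\,syty^*,\\ &xhx^*k\,xy\,sy^*ty\approx xhx^*k\,yx\,sy^*ty, && xhx^*k\,xy\,syty^*\approx xhx^*k\,yx\,syty^*,\\ &xhyk\,xy\,sxty\approx xhyk\,yx\,sxty, && xhyk\,xy\,sytx\approx xhyk\,yx\,sytx,\\ &xhyk\,xy\,sx^*ty^*\approx xhyk\,yx\,sx^*ty^*, && xhyk\,xy\,sy^*tx^*\approx xhyk\,yx\,sy^*tx^*,\\ &x^*hy^*k\,xy\,sx^*ty^*\approx x^*hy^*k\,yx\,sx^*ty^*, && x^*hy^*k\,xy\,sy^*tx^*\approx x^*hy^*k\,yx\,sy^*tx^*,\\ &x^*hxk\,xy\,sxty\approx x^*hxk\,yx\,sxty, && x^*hxk\,xy\,sytx\approx x^*hxk\,yx\,sytx,\\ &xhx^*k\,xy\,sxty\approx xhx^*k\,yx\,sxty, && xhx^*k\,xy\,sytx\approx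 xhx^*k\,yx\,sytx,\\ &x^*hxk\,xy\,sx^*ty^*\approx x^*hxk\,yx\,sx^*ty^*, && x^*hxk\,xy\,sy^*tx^*\approx x^*hxk\,yx\,sy^*tx^*,\\ &xhx^*k\,xy\,sx^*ty^*\approx xhx^*k\,yx\,sx^*ty^*, && xhx^*k\,xy\,sy^*tx^*\approx xhx^*k\,yx\,sy^*tx^*. \end{align*}
   Context: Baxter monoid: for $n\ge 1$ let $\mathcal{A}_n=\{1<2<\cdots<n\}$ and let $\mathcal{A}_n^{\star}$ be the free monoid on $\mathcal{A}_n$. Then $\mathsf{baxt}_n=\mathcal{A}_n^{\star}/\!\equiv$, where $\equiv$ is the congruence generated by all pairs $(c\mathbf{u}ad\mathbf{v}b,\ c\mathbf{u}da\mathbf{v}b)$ with $a\le b<c\le d$ and $(b\mathbf{u}da\mathbf{v}c,\ b\mathbf{u}ad\mathbf{v}c)$ with $a<b\le c<d$, where $a,b,c,d\in\mathcal{A}_n$, $\mathbf{u},\mathbf{v}\in\mathcal{A}_n^{\star}$. Schützenberger's involution $^{\sharp}$ on $\mathsf{baxt}_n$ is induced by $i^{\sharp}=n+1-i$ and $(w_1\cdots w_k)^{\sharp}=w_k^{\sharp}\cdots w_1^{\sharp}$. Terms and identities: $\mathcal{X}$ is a countably infinite alphabet (here $x,y,h,k,s,t\in\mathcal{X}$ are distinct) and $\mathcal{X}^*$ a disjoint copy. $\mathsf{T}(\mathcal{X})$ is the smallest set containing $\mathcal{X}$ and the empty term $\emptyset$ and closed under (associative) concatenation and $^*$; the empty term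 is neutral for concatenation, $\emptyset^*=\emptyset$, and it is evaluated as the unit element. Words over $\mathcal{X}\cup\mathcal{X}^*$ are terms. An identity is an expression $\mathbf{s}\approx\mathbf{t}$ with $\mathbf{s},\mathbf{t}$ nonempty terms; an involution monoid $(M,{}^* )$ satisfies it if every substitution $\mathcal{X}\to M$ gives both sides the same value. $\mathbf{s}\approx\mathbf{t}$ is directly deducible from $\mathbf{p}\approx\mathbf{q}$ if for some substitution $\varphi:\mathcal{X}\to\mathsf{T}(\mathcal{X})$ (values may be empty), $\varphi(\mathbf{p})$ is a subterm of $\mathbf{s}$ and replacing this subterm by $\varphi(\mathbf{q})$ gives $\mathbf{t}$; $\mathbf{s}\approx\mathbf{t}$ is deducible from a set $\Sigma$ if there is a sequence $\mathbf{s}=\mathbf{s}_1,\dots,\mathbf{s}_r=\mathbf{t}$ of terms with each $\mathbf{s}_i\approx\mathbf{s}_{i+1}$ directly deducible from some identity of $\Sigma$ (an identity may be used in either direction). A set $\Sigma$ of identities of $(M,{}^* )$ is an identity basis for $(M,{}^* )$ if every identity satisfied by $(M,{}^* )$ is deducible from $\Sigma$. The reverse of a word identity $\mathbf{u}\approx\mathbf{v}$ is $\overleftarrow{\mathbf{u}}\approx\overleftarrow{\mathbf{v}}$, where $\overleftarrow{\mathbf{u}}$ is $\mathbf{u}$ written in reverse order (letters themselves unchanged, e.g. $\overleftarrow{x^5zy^*}=y^*zx^5$). *)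

theory Defs
  imports "HOL-Algebra.Group" "HOL-Library.Countable_Set"
begin

locale involution_monoid = monoid G for G (structure) +
  fixes invol :: "'a \<Rightarrow> 'a"
  assumes invol_closed: "a \<in> carrier G \<Longrightarrow> invol a \<in> carrier G"
    and invol_invol: "a \<in> carrier G \<Longrightarrow> invol (invol a) = a"
    and invol_mult: "\<lbrakk>a \<in> carrier G; b \<in> carrier G\<rbrakk> \<Longrightarrow> invol (a \<otimes> b) = invol b \<otimes> invol a"
begin

lemma invol_one: "invol \<one> = \<one>"
proof -
  have "invol \<one> = invol \<one> \<otimes> invol (invol \<one>)"
    by (simp add: invol_closed invol_invol)
  also have "\<dots> = invol (invol \<one> \<otimes> \<one>)"
    using invol_mult[of "invol \<one>" \<one>] by (simp add: invol_closed invol_invol)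
  finally show ?thesis by (simp add: invol_closed invol_invol)
qed

end

text \<open>The congruence on the free monoid of words over \<open>{1..n}\<close> that is generated by the two
  families of defining pairs of the Baxter monoid.\<close>

inductive_set baxter_cong :: "nat \<Rightarrow> (nat list \<times> nat list) set" for n :: nat where
  gen1: "\<lbrakk>{a, b, c, d} \<subseteq> {1..n}; u \<in> lists {1..n}; v \<in> lists {1..n}; a \<le> b; b < c; c \<le> d\<rbrakk>
    \<Longrightarrow> ([c] @ u @ [a, d] @ v @ [b], [c] @ u @ [d, a] @ v @ [b]) \<in> baxter_cong n"
| gen2: "\<lbrakk>{a, b, c, d} \<subseteq> {1..n}; u \<in> lists {1..n}; v \<in> lists {1..n}; a < b; b \<le> c; c < d\<rbrakk>
    \<Longrightarrow> ([b] @ u @ [d, a] @ v @ [c], [b] @ u @ [a, d] @ v @ [c]) \<in> baxter_cong n"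
| refl: "w \<in> lists {1..n} \<Longrightarrow> (w, w) \<in> baxter_cong n"
| sym: "(w, w') \<in> baxter_cong n \<Longrightarrow> (w', w) \<in> baxter_cong n"
| trans: "\<lbrakk>(w, w') \<in> baxter_cong n; (w', w'') \<in> baxter_cong n\<rbrakk> \<Longrightarrow> (w, w'') \<in> baxter_cong n"
| mult: "\<lbrakk>(w1, w1') \<in> baxter_cong n; (w2, w2') \<in> baxter_cong n\<rbrakk>
    \<Longrightarrow> (w1 @ w2, w1' @ w2') \<in> baxter_cong n"

definition baxt :: "nat \<Rightarrow> nat list set monoid" where
  "baxt n = \<lparr>carrier = lists {1..n} // baxter_cong n,
     mult = (\<lambda>A B. \<Union>u\<in>A. \<Union>v\<in>B. baxter_cong n `` {u @ v}),
     one = baxter_cong n `` {[]}\<rparr>"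

definition sharp_word :: "nat \<Rightarrow> nat list \<Rightarrow> nat list" where
  "sharp_word n w = rev (map (\<lambda>i. n + 1 - i) w)"

definition schuetzenberger :: "nat \<Rightarrow> nat list set \<Rightarrow> nat list set" where
  "schuetzenberger n A = (\<Union>w\<in>A. baxter_cong n `` {sharp_word n w})"

lemma baxter_cong_lists:
  "(w, w') \<in> baxter_cong n \<Longrightarrow> w \<in> lists {1..n} \<and> w' \<in> lists {1..n}"
  by (induction rule: baxter_cong.induct) auto

lemma equiv_baxter_cong: "equiv (lists {1..n}) (baxter_cong n)"
proof (rule equivI)
  show "baxter_cong n \<subseteq> lists {1..n} \<times> lists {1..n}"
    by (intro subrelI SigmaI) (simp_all only: baxter_cong_lists)
  show "refl_on (lists {1..n}) (baxter_cong n)"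
    by (rule refl_onI) (rule baxter_cong.refl)
  show "sym (baxter_cong n)"
    by (rule symI) (rule baxter_cong.sym)
  show "trans (baxter_cong n)"
    by (rule transI) (rule baxter_cong.trans)
qed

lemma sharp_word_lists: "w \<in> lists {1..n} \<Longrightarrow> sharp_word n w \<in> lists {1..n}"
  by (force simp: sharp_word_def)

lemma sharp_word_append: "sharp_word n (u @ v) = sharp_word n v @ sharp_word n u"
  by (simp add: sharp_word_def)

lemma sharp_word_sharp_word: "w \<in> lists {1..n} \<Longrightarrow> sharp_word n (sharp_word n w) = w"
  by (auto simp: sharp_word_def rev_map intro!: map_idI)

lemma sharp_word_cong:
  "(w, w') \<in> baxter_cong n \<Longrightarrow> (sharp_word n w, sharp_word n w') \<in> baxter_cong n"
proof (induction rule: baxter_cong.induct)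
  case (gen1 a b c d u v)
  then have "([n + 1 - b] @ sharp_word n v @ [n + 1 - d, n + 1 - a] @ sharp_word n u @ [n + 1 - c],
     [n + 1 - b] @ sharp_word n v @ [n + 1 - a, n + 1 - d] @ sharp_word n u @ [n + 1 - c])
       \<in> baxter_cong n"
    by (intro baxter_cong.gen1 sharp_word_lists; force)
  then show ?case by (simp add: sharp_word_def)
next
  case (gen2 a b c d u v)
  then have "([n + 1 - c] @ sharp_word n v @ [n + 1 - a, n + 1 - d] @ sharp_word n u @ [n + 1 - b],
     [n + 1 - c] @ sharp_word n v @ [n + 1 - d, n + 1 - a] @ sharp_word n u @ [n + 1 - b])
       \<in> baxter_cong n"
    by (intro baxter_cong.gen2 sharp_word_lists; force)
  then show ?case by (simp add: sharp_word_def)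
next
  case (refl w)
  then show ?case by (intro baxter_cong.refl sharp_word_lists)
next
  case (sym w w')
  from sym.IH show ?case by (rule baxter_cong.sym)
next
  case (trans w w' w'')
  from trans.IH show ?case by (rule baxter_cong.trans)
next
  case (mult w1 w1' w2 w2')
  then show ?case by (simp add: sharp_word_append baxter_cong.mult)
qed

lemma baxt_mult_class:
  assumes "u \<in> lists {1..n}" "v \<in> lists {1..n}"
  shows "baxter_cong n `` {u} \<otimes>\<^bsub>baxt n\<^esub> baxter_cong n `` {v} = baxter_cong n `` {u @ v}"
proof -
  have "congruent2 (baxter_cong n) (baxter_cong n) (\<lambda>u v. baxter_cong n `` {u @ v})"
    by (rule congruent2I') (rule equiv_class_eq[OF equiv_baxter_cong], rule baxter_cong.mult)
  from UN_equiv_class2[OF equiv_baxter_cong equiv_baxter_cong this assms]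
  show ?thesis by (simp only: baxt_def monoid.simps)
qed

lemma schuetzenberger_class:
  assumes "w \<in> lists {1..n}"
  shows "schuetzenberger n (baxter_cong n `` {w}) = baxter_cong n `` {sharp_word n w}"
proof -
  have "congruent (baxter_cong n) (\<lambda>w. baxter_cong n `` {sharp_word n w})"
    by (rule congruentI) (rule equiv_class_eq[OF equiv_baxter_cong], rule sharp_word_cong)
  from UN_equiv_class[OF equiv_baxter_cong this assms]
  show ?thesis by (simp only: schuetzenberger_def)
qed

lemma carrier_baxt: "carrier (baxt n) = (\<lambda>w. baxter_cong n `` {w}) ` lists {1..n}"
  by (auto simp: baxt_def quotient_def)

lemma one_baxt: "\<one>\<^bsub>baxt n\<^esub> = baxter_cong n `` {[]}"
  by (simp add: baxt_def)

lemma involution_monoid_baxt: "involution_monoid (baxt n) (schuetzenberger n)"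
proof -
  let ?c = "\<lambda>w. baxter_cong n `` {w}"
  have carr: "\<exists>w. w \<in> lists {1..n} \<and> A = ?c w" if "A \<in> carrier (baxt n)" for A
    using that unfolding carrier_baxt by blast
  have in_carr: "?c w \<in> carrier (baxt n)" if "w \<in> lists {1..n}" for w
    using that unfolding carrier_baxt by (rule imageI)
  note app = append_in_lists_conv[THEN iffD2, OF conjI]
  show ?thesis
  proof (unfold_locales, goal_cases)
    case (1 A B)
    then obtain u v where "u \<in> lists {1..n}" "v \<in> lists {1..n}" "A = ?c u" "B = ?c v"
      using carr by meson
    then show ?case by (simp only: baxt_mult_class in_carr app)
  next
    case (2 A B C)
    then obtain u v w where "u \<in> lists {1..n}" "v \<in> lists {1..n}" "w \<in> lists {1..n}"
      "A = ?c u" "B = ?c v" "C = ?c w"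
      using carr by meson
    then show ?case by (simp only: baxt_mult_class app append_assoc)
  next
    case 3
    show ?case unfolding one_baxt by (rule in_carr) simp
  next
    case (4 A)
    then obtain u where "u \<in> lists {1..n}" "A = ?c u" using carr by meson
    then show ?case by (simp only: one_baxt baxt_mult_class lists.Nil append_Nil)
  next
    case (5 A)
    then obtain u where "u \<in> lists {1..n}" "A = ?c u" using carr by meson
    then show ?case by (simp only: one_baxt baxt_mult_class lists.Nil append_Nil2)
  next
    case (6 A)
    then obtain u where "u \<in> lists {1..n}" "A = ?c u" using carr by meson
    then show ?case by (simp only: schuetzenberger_class in_carr sharp_word_lists)
  next
    case (7 A)
    then obtain u where "u \<in> lists {1..n}" "A = ?c u" using carr by meson
    then show ?case by (simp only: schuetzenberger_class sharp_word_lists sharp_word_sharp_word)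
  next
    case (8 A B)
    then obtain u v where "u \<in> lists {1..n}" "v \<in> lists {1..n}" "A = ?c u" "B = ?c v"
      using carr by meson
    then show ?case
      by (simp only: baxt_mult_class schuetzenberger_class sharp_word_append sharp_word_lists app)
  qed
qed

text \<open>A term is represented by its unique decomposition into factors that are not themselves
  proper products: a letter, or the star of a nonempty term (\<open>Star a as\<close> is the star of the term
  \<open>a # as\<close>). Concatenation is then \<open>@\<close>, which is associative with neutral element the empty
  term \<open>[]\<close>, and the star of the empty term is the empty term. A word over the letters and
  their starred copies is a term all of whose factors are \<open>Var x\<close> or \<open>Star (Var x) []\<close>.\<close>

datatype 'x factor = Var 'x | Star "'x factor" "'x factor list"

type_synonym 'x trm = "'x factor list"

fun star :: "'x trm \<Rightarrow> 'x trm" where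
  "star [] = []"
| "star (a # as) = [Star a as]"

lemma trm_induct [case_names Empty Var Concat Star]:
  fixes P :: "'x trm \<Rightarrow> bool"
  assumes Empty: "P []" and Var: "\<And>x. P [Var x]"
    and Concat: "\<And>u v. P u \<Longrightarrow> P v \<Longrightarrow> P (u @ v)" and Star: "\<And>u. P u \<Longrightarrow> P (star u)"
  shows "P u"
proof -
  have list: "P as" if "\<And>b. b \<in> set as \<Longrightarrow> P [b]" for as :: "'x trm"
    using that
  proof (induction as)
    case (Cons a as)
    then show ?case using Concat[of "[a]" as] by simp
  qed (rule Empty)
  have "P [a]" for a
  proof (induction a)
    case (Star a as)
    have "P ([a] @ as)" by (rule Concat[OF Star.IH(1) list[OF Star.IH(2)]])
    then show ?case using assms(4)[of "a # as"] by simp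
  qed (rule Var)
  then show ?thesis by (rule list)
qed

primrec eval_factor :: "('a, 'm) monoid_scheme \<Rightarrow> ('a \<Rightarrow> 'a) \<Rightarrow> ('x \<Rightarrow> 'a) \<Rightarrow> 'x factor \<Rightarrow> 'a" where
  "eval_factor G invol \<theta> (Var x) = \<theta> x"
| "eval_factor G invol \<theta> (Star a as) =
     invol (eval_factor G invol \<theta> a
       \<otimes>\<^bsub>G\<^esub> foldr (mult G) (map (eval_factor G invol \<theta>) as) \<one>\<^bsub>G\<^esub>)"

definition eval_trm :: "('a, 'm) monoid_scheme \<Rightarrow> ('a \<Rightarrow> 'a) \<Rightarrow> ('x \<Rightarrow> 'a) \<Rightarrow> 'x trm \<Rightarrow> 'a" where
  "eval_trm G invol \<theta> u = foldr (mult G) (map (eval_factor G invol \<theta>) u) \<one>\<^bsub>G\<^esub>"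

context involution_monoid
begin

lemma eval_trm_Empty: "eval_trm G invol \<theta> [] = \<one>"
  by (simp add: eval_trm_def)

lemma eval_trm_Var: "\<theta> x \<in> carrier G \<Longrightarrow> eval_trm G invol \<theta> [Var x] = \<theta> x"
  by (simp add: eval_trm_def)

lemma eval_factor_closed: "range \<theta> \<subseteq> carrier G \<Longrightarrow> eval_factor G invol \<theta> a \<in> carrier G"
proof (induction a)
  case (Star a as)
  then have "foldr (\<otimes>) (map (eval_factor G invol \<theta>) as) \<one> \<in> carrier G"
    by (induction as) auto
  with Star show ?case by (simp add: invol_closed)
qed auto

lemma eval_trm_closed: "range \<theta> \<subseteq> carrier G \<Longrightarrow> eval_trm G invol \<theta> u \<in> carrier G"
  by (induction u) (simp_all add: eval_trm_def eval_factor_closed)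

lemma eval_trm_append:
  "range \<theta> \<subseteq> carrier G \<Longrightarrow>
    eval_trm G invol \<theta> (u @ v) = eval_trm G invol \<theta> u \<otimes> eval_trm G invol \<theta> v"
proof (induction u)
  case Nil
  then show ?case using eval_trm_closed[of \<theta> v] by (simp add: eval_trm_Empty)
next
  case (Cons a u)
  have "eval_trm G invol \<theta> (a # w) = eval_factor G invol \<theta> a \<otimes> eval_trm G invol \<theta> w" for w
    by (simp add: eval_trm_def)
  then show ?case
    using Cons eval_trm_closed[of \<theta>] eval_factor_closed[of \<theta>] by (simp add: m_assoc)
qed

lemma eval_trm_star:
  assumes "range \<theta> \<subseteq> carrier G"
  shows "eval_trm G invol \<theta> (star u) = invol (eval_trm G invol \<theta> u)"
proof (cases u)
  case Nil
  then show ?thesis by (simp add: eval_trm_Empty invol_one)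
next
  case (Cons a as)
  then show ?thesis
    using eval_trm_closed[OF assms, of u] by (simp add: eval_trm_def invol_closed)
qed

end

primrec subst_factor :: "('x \<Rightarrow> 'y trm) \<Rightarrow> 'x factor \<Rightarrow> 'y trm" where
  "subst_factor \<phi> (Var x) = \<phi> x"
| "subst_factor \<phi> (Star a as) = star (subst_factor \<phi> a @ concat (map (subst_factor \<phi>) as))"

definition subst_trm :: "('x \<Rightarrow> 'y trm) \<Rightarrow> 'x trm \<Rightarrow> 'y trm" where
  "subst_trm \<phi> u = concat (map (subst_factor \<phi>) u)"

lemma subst_trm_simps:
  "subst_trm \<phi> [] = []" "subst_trm \<phi> [Var x] = \<phi> x"
  "subst_trm \<phi> (u @ v) = subst_trm \<phi> u @ subst_trm \<phi> v"
  "subst_trm \<phi> (star u) = star (subst_trm \<phi> u)"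
  by (simp_all add: subst_trm_def) (cases u; simp)

type_synonym 'x identity = "'x trm \<times> 'x trm"

definition is_identity :: "'x identity \<Rightarrow> bool" where
  "is_identity e \<longleftrightarrow> fst e \<noteq> [] \<and> snd e \<noteq> []"

definition satisfies :: "('a, 'm) monoid_scheme \<Rightarrow> ('a \<Rightarrow> 'a) \<Rightarrow> 'x identity \<Rightarrow> bool" where
  "satisfies G invol e \<longleftrightarrow>
     (\<forall>\<theta>. range \<theta> \<subseteq> carrier G \<longrightarrow> eval_trm G invol \<theta> (fst e) = eval_trm G invol \<theta> (snd e))"

text \<open>\<open>directly_deducible p q s t\<close>: \<open>t\<close> arises from \<open>s\<close> by replacing one subterm occurrence
  \<open>\<phi>(p)\<close> by \<open>\<phi>(q)\<close>; the last three rules build up the context of that occurrence.\<close>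

inductive directly_deducible :: "'x trm \<Rightarrow> 'x trm \<Rightarrow> 'x trm \<Rightarrow> 'x trm \<Rightarrow> bool"
  for p q :: "'x trm" where
  inst: "directly_deducible p q (subst_trm \<phi> p) (subst_trm \<phi> q)"
| left: "directly_deducible p q s t \<Longrightarrow> directly_deducible p q (u @ s) (u @ t)"
| right: "directly_deducible p q s t \<Longrightarrow> directly_deducible p q (s @ u) (t @ u)"
| star: "directly_deducible p q s t \<Longrightarrow> directly_deducible p q (star s) (star t)"

definition deducible :: "'x identity set \<Rightarrow> 'x trm \<Rightarrow> 'x trm \<Rightarrow> bool" where
  "deducible \<Sigma> =
     (\<lambda>s t. \<exists>(p, q)\<in>\<Sigma>. directly_deducible p q s t \<or> directly_deducible q p s t)\<^sup>*\<^sup>*"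

definition identity_basis ::
  "('a, 'm) monoid_scheme \<Rightarrow> ('a \<Rightarrow> 'a) \<Rightarrow> 'x identity set \<Rightarrow> bool" where
  "identity_basis G invol \<Sigma> \<longleftrightarrow>
     (\<forall>e\<in>\<Sigma>. is_identity e \<and> satisfies G invol e) \<and>
     (\<forall>s t. is_identity (s, t) \<and> satisfies G invol (s, t) \<longrightarrow> deducible \<Sigma> s t)"

text \<open>For words over the letters and their starred copies: the order of the letters is reversed,
  the letters themselves (starred or not) are unchanged.\<close>

definition reverse_identity :: "'x identity \<Rightarrow> 'x identity" where
  "reverse_identity e = (rev (fst e), rev (snd e))"

definition involution_identities :: "'x \<Rightarrow> 'x \<Rightarrow> 'x identity set" where
  "involution_identities x y =
     {(star (star [Var x]), [Var x]),
      (star ([Var x] @ [Var y]), star [Var y] @ star [Var x])}"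

definition baxt2_word_identities ::
  "'x \<Rightarrow> 'x \<Rightarrow> 'x \<Rightarrow> 'x \<Rightarrow> 'x \<Rightarrow> 'x \<Rightarrow> 'x identity set" where
  "baxt2_word_identities x y h k s t =
    (let X = Var x; X' = Star (Var x) []; Y = Var y; Y' = Star (Var y) [];
         H = Var h; K = Var k; S = Var s; T = Var t in {
      ([X', H, X, K, X, Y, S, X', T, X], [X', H, X, K, Y, X, S, X', T, X]),
      ([X', H, X, K, X, Y, S, X, T, X'], [X', H, X, K, Y, X, S, X, T, X']),
      ([X, H, X', K, X, Y, S, X', T, X], [X, H, X', K, Y, X, S, X', T, X]),
      ([X, H, X', K, X, Y, S, X, T, X'], [X, H, X', K, Y, X, S, X, T, X']),
      ([X', H, X, K, X, Y, S, Y', T, Y], [X', H, X, K, Y, X, S, Y', T, Y]),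
      ([X', H, X, K, X, Y, S, Y, T, Y'], [X', H, X, K, Y, X, S, Y, T, Y']),
      ([X, H, X', K, X, Y, S, Y', T, Y], [X, H, X', K, Y, X, S, Y', T, Y]),
      ([X, H, X', K, X, Y, S, Y, T, Y'], [X, H, X', K, Y, X, S, Y, T, Y']),
      ([X, H, Y, K, X, Y, S, X, T, Y], [X, H, Y, K, Y, X, S, X, T, Y]),
      ([X, H, Y, K, X, Y, S, Y, T, X], [X, H, Y, K, Y, X, S, Y, T, X]),
      ([X, H, Y, K, X, Y, S, X', T, Y'], [X, H, Y, K, Y, X, S, X', T, Y']),
      ([X, H, Y, K, X, Y, S, Y', T, X'], [X, H, Y, K, Y, X, S, Y', T, X']),
      ([X', H, Y', K, X, Y, S, X', T, Y'], [X', H, Y', K, Y, X, S, X', T, Y']),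
      ([X', H, Y', K, X, Y, S, Y', T, X'], [X', H, Y', K, Y, X, S, Y', T, X']),
      ([X', H, X, K, X, Y, S, X, T, Y], [X', H, X, K, Y, X, S, X, T, Y]),
      ([X', H, X, K, X, Y, S, Y, T, X], [X', H, X, K, Y, X, S, Y, T, X]),
      ([X, H, X', K, X, Y, S, X, T, Y], [X, H, X', K, Y, X, S, X, T, Y]),
      ([X, H, X', K, X, Y, S, Y, T, X], [X, H, X', K, Y, X, S, Y, T, X]),
      ([X', H, X, K, X, Y, S, X', T, Y'], [X', H, X, K, Y, X, S, X', T, Y']),
      ([X', H, X, K, X, Y, S, Y', T, X'], [X', H, X, K, Y, X, S, Y', T, X']),
      ([X, H, X', K, X, Y, S, X', T, Y'], [X, H, X', K, Y, X, S, X', T, Y']),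
      ([X, H, X', K, X, Y, S, Y', T, X'], [X, H, X', K, Y, X, S, Y', T, X'])
    })"

end

theory Submission
  imports Defs
begin

text \<open>In \<open>baxt 2\<close> two words over \<open>{1, 2}\<close> are equal iff they agree in content, in the number of
  leading 1s and in the number of trailing 2s: everything between the first 2 and the last 1
  commutes. The involution identities turn every term into a word over letters and starred
  letters, and for such words the remaining identities say that adjacent literals \<open>a\<close>, \<open>c\<close> may be
  exchanged when both the part before and the part after them meet \<open>{a, c\<^sup>*}\<close> as well as
  \<open>{a\<^sup>*, c}\<close>. If \<open>u \<approx> v\<close> holds, then \<open>v\<close> is bubble-sorted into \<open>u\<close>: substituting powers of 1 and 2
  for \<open>a\<close> and \<open>c\<close> and the empty word for all other letters shows that every exchange
  needed is of this kind.\<close>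

section \<open>The Baxter congruence on two letters\<close>

text \<open>With a = b = 1 and c = d = 2 the first generating family reads 2 u 12 v 1 ~ 2 u 21 v 1.
  A 2 in \<open>P\<close> and a 1 in \<open>Q\<close> supply the outer letters, and what lies
  between them and the swapped pair is absorbed into u and v.\<close>

lemma baxter_cong_2_swap_letters:
  assumes "P \<in> lists {1..2}" "Q \<in> lists {1..2}" "2 \<in> set P" "1 \<in> set Q"
    and "e \<in> {1..2}" "f \<in> {1..2}"
  shows "(P @ [e, f] @ Q, P @ [f, e] @ Q) \<in> baxter_cong 2"
proof -
  obtain p1 p2 where P: "P = p1 @ 2 # p2" using split_list[OF assms(3)] by blast
  obtain q1 q2 where Q: "Q = q1 @ 1 # q2" using split_list[OF assms(4)] by blast
  have l: "p1 \<in> lists {1..2}" "p2 \<in> lists {1..2}" "q1 \<in> lists {1..2}" "q2 \<in> lists {1..2}"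
    using assms(1,2) by (auto simp: P Q)
  have "([2] @ p2 @ [1, 2] @ q1 @ [1], [2] @ p2 @ [2, 1] @ q1 @ [1]) \<in> baxter_cong 2"
    by (rule baxter_cong.gen1) (use l in auto)
  from baxter_cong.mult[OF baxter_cong.refl[OF l(1)] baxter_cong.mult[OF this baxter_cong.refl[OF l(4)]]]
  have 12: "(P @ [1, 2] @ Q, P @ [2, 1] @ Q) \<in> baxter_cong 2"
    by (simp add: P Q)
  have "e = 1 \<or> e = 2" "f = 1 \<or> f = 2" using assms(5,6) by auto
  then show ?thesis
    using 12 baxter_cong.sym[OF 12] assms(1,2)
    by (elim disjE) (auto intro!: baxter_cong.refl)
qed

lemma baxter_cong_2_move_letter:
  assumes "P \<in> lists {1..2}" "Q \<in> lists {1..2}" "2 \<in> set P" "1 \<in> set Q"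
    and "e \<in> {1..2}" "S \<in> lists {1..2}"
  shows "(P @ [e] @ S @ Q, P @ S @ [e] @ Q) \<in> baxter_cong 2"
  using assms
proof (induction S arbitrary: P)
  case Nil
  then show ?case by (auto intro!: baxter_cong.refl)
next
  case (Cons f S)
  have "(P @ [e, f] @ (S @ Q), P @ [f, e] @ (S @ Q)) \<in> baxter_cong 2"
    by (rule baxter_cong_2_swap_letters) (use Cons.prems in auto)
  moreover have "((P @ [f]) @ [e] @ S @ Q, (P @ [f]) @ S @ [e] @ Q) \<in> baxter_cong 2"
    by (rule Cons.IH) (use Cons.prems in auto)
  ultimately show ?case by (auto intro: baxter_cong.trans)
qed

text \<open>Adjacent literals take whole words as values, so the exchange of letters is lifted to
  blocks: the tail of \<open>R\<close> passes \<open>S\<close> first, behind the longer prefix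
  \<open>P @ [e]\<close>, then its head \<open>e\<close> does.\<close>

lemma baxter_cong_2_commute:
  assumes "P \<in> lists {1..2}" "Q \<in> lists {1..2}" "2 \<in> set P" "1 \<in> set Q"
    and "R \<in> lists {1..2}" "S \<in> lists {1..2}"
  shows "(P @ R @ S @ Q, P @ S @ R @ Q) \<in> baxter_cong 2"
  using assms
proof (induction R arbitrary: P)
  case Nil
  then show ?case by (auto intro!: baxter_cong.refl)
next
  case (Cons e R)
  have "((P @ [e]) @ R @ S @ Q, (P @ [e]) @ S @ R @ Q) \<in> baxter_cong 2"
    by (rule Cons.IH) (use Cons.prems in auto)
  moreover have "(P @ [e] @ S @ (R @ Q), P @ S @ [e] @ (R @ Q)) \<in> baxter_cong 2"
    by (rule baxter_cong_2_move_letter) (use Cons.prems in auto)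
  ultimately show ?case by (auto intro: baxter_cong.trans)
qed

section \<open>Content, leading 1s and trailing 2s as invariants of the congruence\<close>

lemma length_takeWhile_append:
  "length (takeWhile P (u @ v)) =
    (if \<forall>i\<in>set u. P i then length u + length (takeWhile P v) else length (takeWhile P u))"
  by (induction u) auto

lemma baxter_cong_count:
  "(w, w') \<in> baxter_cong n \<Longrightarrow> count_list w i = count_list w' i"
  by (induction rule: baxter_cong.induct) auto

lemma baxter_cong_set: "(w, w') \<in> baxter_cong n \<Longrightarrow> set w = set w'"
  by (induction rule: baxter_cong.induct) auto

lemma baxter_cong_length: "(w, w') \<in> baxter_cong n \<Longrightarrow> length w = length w'"
  by (induction rule: baxter_cong.induct) auto

text \<open>Both sides of a defining pair begin with the same letter, which exceeds \<open>a\<close>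
  and so is not 1. In a product, the leading block reaches the second factor iff the first consists
  of 1s only, which depends on its set of letters alone.\<close>

lemma baxter_cong_2_leading:
  assumes "(w, w') \<in> baxter_cong 2"
  shows "length (takeWhile (\<lambda>k. k = 1) w) = length (takeWhile (\<lambda>k. k = 1) w')"
proof -
  have "n = 2 \<longrightarrow> length (takeWhile (\<lambda>k. k = 1) w) = length (takeWhile (\<lambda>k. k = 1) w')"
    if "(w, w') \<in> baxter_cong n" for n
    using that
  proof (induction rule: baxter_cong.induct)
    case (mult w1 w1' w2 w2')
    then show ?case
      using baxter_cong_set[OF mult.hyps(1)] baxter_cong_length[OF mult.hyps(1)]
      unfolding length_takeWhile_append by auto
  qed auto
  with assms show ?thesis by simp
qed

text \<open>Both sides of a defining pair end in the same letter, which is smaller than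
  \<open>d\<close> and hence not 2 when \<open>n = 2\<close>. Products are treated as for leading
  1s, from the right.\<close>

lemma baxter_cong_2_trailing:
  assumes "(w, w') \<in> baxter_cong 2"
  shows "length (takeWhile (\<lambda>k. k = 2) (rev w)) = length (takeWhile (\<lambda>k. k = 2) (rev w'))"
proof -
  have "n = 2 \<longrightarrow> length (takeWhile (\<lambda>k. k = 2) (rev w)) = length (takeWhile (\<lambda>k. k = 2) (rev w'))"
    if "(w, w') \<in> baxter_cong n" for n
    using that
  proof (induction rule: baxter_cong.induct)
    case (mult w1 w1' w2 w2')
    then show ?case
      using baxter_cong_set[OF mult.hyps(2)] baxter_cong_length[OF mult.hyps(2)]
      unfolding rev_append length_takeWhile_append by auto
  qed auto
  with assms show ?thesis by simp
qed

section \<open>Words over letters and starred letters\<close>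

text \<open>\<open>(z, False)\<close> stands for the letter \<open>z\<close> and \<open>(z, True)\<close> for its starred copy.\<close>

type_synonym 'x literal = "'x \<times> bool"

text \<open>The star of a literal, with a double star already cancelled.\<close>

definition bar :: "'x literal \<Rightarrow> 'x literal" where
  "bar l = (fst l, \<not> snd l)"

lemma bar_bar [simp]: "bar (bar l) = l"
  and bar_neq [simp]: "bar l \<noteq> l" "l \<noteq> bar l"
  and bar_eq_iff [simp]: "bar l = bar l' \<longleftrightarrow> l = l'"
  by (cases l; cases l'; simp add: bar_def)+

lemma bar_Pair [simp]: "bar (z, b) = (z, \<not> b)"
  by (simp add: bar_def)

fun literal_factor :: "'x literal \<Rightarrow> 'x factor" where
  "literal_factor (z, False) = Var z"
| "literal_factor (z, True) = Star (Var z) []"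

abbreviation word_trm :: "'x literal list \<Rightarrow> 'x trm" where
  "word_trm \<equiv> map literal_factor"

text \<open>The word to which the involution identities reduce a factor: stars move inwards,
  reversing the order, and double stars cancel.\<close>

primrec norm_factor :: "'x factor \<Rightarrow> 'x literal list" where
  "norm_factor (Var z) = [(z, False)]"
| "norm_factor (Star a as) = map bar (rev (norm_factor a @ concat (map norm_factor as)))"

definition norm_trm :: "'x trm \<Rightarrow> 'x literal list" where
  "norm_trm u = concat (map norm_factor u)"

lemma norm_trm_simps [simp]:
  "norm_trm [] = []" "norm_trm [Var z] = [(z, False)]"
  "norm_trm (u @ v) = norm_trm u @ norm_trm v"
  "norm_trm (star u) = map bar (rev (norm_trm u))"
  by (simp_all add: norm_trm_def) (cases u; simp)

lemma norm_trm_word_trm [simp]: "norm_trm (word_trm u) = u"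
proof (induction u)
  case (Cons l u)
  have "norm_factor (literal_factor l) = [l]"
    by (cases l rule: literal_factor.cases) auto
  with Cons show ?case by (simp add: norm_trm_def)
qed simp

section \<open>Satisfaction in \<open>baxt 2\<close> in terms of representing words\<close>

definition literal_value :: "('x \<Rightarrow> nat list) \<Rightarrow> 'x literal \<Rightarrow> nat list" where
  "literal_value \<theta> l = (if snd l then sharp_word 2 (\<theta> (fst l)) else \<theta> (fst l))"

definition word_value :: "('x \<Rightarrow> nat list) \<Rightarrow> 'x literal list \<Rightarrow> nat list" where
  "word_value \<theta> u = concat (map (literal_value \<theta>) u)"

lemma word_value_simps [simp]:
  "word_value \<theta> [] = []" "word_value \<theta> (l # u) = literal_value \<theta> l @ word_value \<theta> u"
  "word_value \<theta> (u @ v) = word_value \<theta> u @ word_value \<theta> v"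
  by (simp_all add: word_value_def)

lemma set_word_value: "set (word_value \<theta> u) = (\<Union>l\<in>set u. set (literal_value \<theta> l))"
  by (simp add: word_value_def)

lemma literal_value_lists:
  "range \<theta> \<subseteq> lists {1..2} \<Longrightarrow> literal_value \<theta> l \<in> lists {1..2}"
  using sharp_word_lists[of "\<theta> (fst l)" 2] by (auto simp: literal_value_def)

lemma word_value_lists: "range \<theta> \<subseteq> lists {1..2} \<Longrightarrow> word_value \<theta> u \<in> lists {1..2}"
  using literal_value_lists[of \<theta>] by (induction u) auto

lemma literal_value_bar:
  "range \<theta> \<subseteq> lists {1..2} \<Longrightarrow> literal_value \<theta> (bar l) = sharp_word 2 (literal_value \<theta> l)"
  by (simp add: literal_value_def bar_def sharp_word_sharp_word range_subsetD)

lemma word_value_bar: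
  "range \<theta> \<subseteq> lists {1..2} \<Longrightarrow> word_value \<theta> (map bar (rev u)) = sharp_word 2 (word_value \<theta> u)"
  by (induction u) (simp_all add: literal_value_bar sharp_word_append, simp add: sharp_word_def)

definition word_identity :: "'x literal list \<Rightarrow> 'x literal list \<Rightarrow> bool" where
  "word_identity u v \<longleftrightarrow>
    (\<forall>\<theta>. range \<theta> \<subseteq> lists {1..2} \<longrightarrow> (word_value \<theta> u, word_value \<theta> v) \<in> baxter_cong 2)"

text \<open>By induction on terms: products and the involution of classes are computed on
  representatives, and \<open>word_value_bar\<close> matches the star of a normal form with the
  involution on words.\<close>

lemma eval_trm_baxt:
  assumes "range \<theta> \<subseteq> lists {1..2}"
  shows "eval_trm (baxt 2) (schuetzenberger 2) (\<lambda>z. baxter_cong 2 `` {\<theta> z}) u =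
    baxter_cong 2 `` {word_value \<theta> (norm_trm u)}"
proof -
  interpret involution_monoid "baxt 2" "schuetzenberger 2"
    by (rule involution_monoid_baxt)
  have c: "range (\<lambda>z. baxter_cong 2 `` {\<theta> z}) \<subseteq> carrier (baxt 2)"
    using assms by (auto simp: carrier_baxt)
  show ?thesis
  proof (induction u rule: trm_induct)
    case Empty
    then show ?case by (simp add: eval_trm_Empty one_baxt)
  next
    case (Var z)
    have "baxter_cong 2 `` {\<theta> z} \<in> carrier (baxt 2)" using c by blast
    then show ?case
      by (simp add: eval_trm_Var[of "\<lambda>z. baxter_cong 2 `` {\<theta> z}"] literal_value_def)
  next
    case (Concat u v)
    then show ?case
      by (simp only: eval_trm_append[OF c] norm_trm_simps word_value_simps
          baxt_mult_class[OF word_value_lists word_value_lists] assms)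
  next
    case (Star u)
    then show ?case
      by (simp only: eval_trm_star[OF c] norm_trm_simps word_value_bar[OF assms]
          schuetzenberger_class[OF word_value_lists[OF assms]])
  qed
qed

text \<open>Choosing a representative of each class lifts any substitution into
  \<open>baxt 2\<close> to one into words, so terms can be replaced by their normal forms and
  equality of classes by congruence.\<close>

lemma satisfies_baxt_iff:
  "satisfies (baxt 2) (schuetzenberger 2) (u, v) \<longleftrightarrow> word_identity (norm_trm u) (norm_trm v)"
proof
  assume s: "satisfies (baxt 2) (schuetzenberger 2) (u, v)"
  show "word_identity (norm_trm u) (norm_trm v)"
    unfolding word_identity_def
  proof (intro allI impI)
    fix \<theta> :: "'a \<Rightarrow> nat list" assume \<theta>: "range \<theta> \<subseteq> lists {1..2}"
    then have "range (\<lambda>z. baxter_cong 2 `` {\<theta> z}) \<subseteq> carrier (baxt 2)"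
      by (auto simp: carrier_baxt)
    from s[unfolded satisfies_def, rule_format, OF this]
    have "baxter_cong 2 `` {word_value \<theta> (norm_trm u)} =
        baxter_cong 2 `` {word_value \<theta> (norm_trm v)}"
      by (simp only: fst_conv snd_conv eval_trm_baxt[OF \<theta>])
    then show "(word_value \<theta> (norm_trm u), word_value \<theta> (norm_trm v)) \<in> baxter_cong 2"
      by (rule eq_equiv_class[OF _ equiv_baxter_cong word_value_lists[OF \<theta>]])
  qed
next
  assume w: "word_identity (norm_trm u) (norm_trm v)"
  show "satisfies (baxt 2) (schuetzenberger 2) (u, v)"
    unfolding satisfies_def
  proof (intro allI impI)
    fix \<eta> :: "'a \<Rightarrow> nat list set" assume "range \<eta> \<subseteq> carrier (baxt 2)"
    then have "\<forall>z. \<exists>w. w \<in> lists {1..2} \<and> \<eta> z = baxter_cong 2 `` {w}"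
      unfolding carrier_baxt by blast
    then obtain \<theta> where "\<forall>z. \<theta> z \<in> lists {1..2} \<and> \<eta> z = baxter_cong 2 `` {\<theta> z}"
      by metis
    then have \<theta>: "range \<theta> \<subseteq> lists {1..2}" and \<eta>: "\<eta> = (\<lambda>z. baxter_cong 2 `` {\<theta> z})"
      by auto
    show "eval_trm (baxt 2) (schuetzenberger 2) \<eta> (fst (u, v)) =
        eval_trm (baxt 2) (schuetzenberger 2) \<eta> (snd (u, v))"
      using w \<theta> equiv_class_eq[OF equiv_baxter_cong]
      by (simp add: \<eta> eval_trm_baxt word_identity_def)
  qed
qed

section \<open>Exchanging adjacent literals\<close>

definition balanced :: "'x literal \<Rightarrow> 'x literal \<Rightarrow> 'x literal list \<Rightarrow> bool" where
  "balanced a c p \<longleftrightarrow> (a \<in> set p \<or> bar c \<in> set p) \<and> (bar a \<in> set p \<or> c \<in> set p)"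

text \<open>The notion \<open>balanced\<close> is symmetric in \<open>a\<close> and
  \<open>c\<close>, so exchanges can be undone by exchanges. The case \<open>c = bar a\<close> is
  included.\<close>

inductive exchange :: "'x literal list \<Rightarrow> 'x literal list \<Rightarrow> bool" where
  "a \<noteq> c \<Longrightarrow> balanced a c p \<Longrightarrow> balanced a c q \<Longrightarrow> exchange (p @ [a, c] @ q) (p @ [c, a] @ q)"

text \<open>If \<open>i\<close> is missing from the value of \<open>p\<close>, literals in
  \<open>p\<close> have powers of the other letter \<open>j\<close> as values, and literals whose
  bar is in \<open>p\<close> have powers of \<open>i\<close>. Balance then leaves two possibilities:
  one of \<open>a\<close>, \<open>c\<close> occurs in \<open>p\<close> together with its bar and has
  empty value, or the values of \<open>a\<close> and \<open>c\<close> are powers of the same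
  letter.\<close>

lemma balanced_values_commute:
  assumes \<theta>: "range \<theta> \<subseteq> lists {1..2}" and p: "balanced a c p"
    and i: "i \<in> {1, 2}" "i \<notin> set (word_value \<theta> p)"
  shows "literal_value \<theta> a @ literal_value \<theta> c = literal_value \<theta> c @ literal_value \<theta> a"
proof -
  \<comment> \<open>The other letter, which is also the image of \<open>i\<close> under the
    involution.\<close>
  define j where "j = 3 - i"
  have ij: "i = 1 \<and> j = 2 \<or> i = 2 \<and> j = 1"
    using i(1) by (auto simp: j_def)
  have "set (literal_value \<theta> l) \<subseteq> {1..2}" for l
    using literal_value_lists[OF \<theta>, of l] by (simp only: in_lists_conv_set subset_iff) blast
  moreover have "{1..2} = {i, j}"
    using ij by (elim disjE conjE) auto
  ultimately have lit: "set (literal_value \<theta> l) \<subseteq> {i, j}" for l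
    by (simp only:)
  have only_j: "set (literal_value \<theta> l) \<subseteq> {j}" if "l \<in> set p" for l
    using lit[of l] i(2) that unfolding set_word_value by blast
  have only_i: "set (literal_value \<theta> l) \<subseteq> {i}" if "bar l \<in> set p" for l
  proof
    fix k assume k: "k \<in> set (literal_value \<theta> l)"
    then have "3 - k \<in> set (literal_value \<theta> (bar l))"
      unfolding literal_value_bar[OF \<theta>] by (simp add: sharp_word_def)
    then have "3 - k = j" using only_j[OF that] by blast
    moreover have "k = i \<or> k = j" using lit[of l] k by blast
    ultimately show "k \<in> {i}" using ij by (elim disjE conjE) simp_all
  qed
  have const: "literal_value \<theta> a @ literal_value \<theta> c = literal_value \<theta> c @ literal_value \<theta> a"
    if "set (literal_value \<theta> a) \<subseteq> {k}" "set (literal_value \<theta> c) \<subseteq> {k}" for k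
  proof -
    have "literal_value \<theta> l = replicate (length (literal_value \<theta> l)) k"
      if "set (literal_value \<theta> l) \<subseteq> {k}" for l
      using that by (intro replicate_eqI) auto
    with that obtain m n where "literal_value \<theta> a = replicate m k" "literal_value \<theta> c = replicate n k"
      by blast
    then show ?thesis by (simp add: add.commute flip: replicate_add)
  qed
  have empty: "literal_value \<theta> l = []" if "l \<in> set p" "bar l \<in> set p" for l
    using only_i[OF that(2)] only_j[OF that(1)] ij by (cases "literal_value \<theta> l") auto
  from p consider "a \<in> set p" "bar a \<in> set p" | "a \<in> set p" "c \<in> set p"
    | "bar c \<in> set p" "bar a \<in> set p" | "bar c \<in> set p" "c \<in> set p"
    by (auto simp: balanced_def)
  then show ?thesis
    by cases (auto simp: empty intro: const[OF only_i only_i] const[OF only_j only_j])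
qed

text \<open>Either the value of \<open>p\<close> contains a 2 and that of \<open>q\<close> a 1, so
  that everything between them commutes modulo the congruence, or one context misses a letter and
  the two values already commute as words.\<close>

lemma exchange_word_identity:
  assumes "exchange u v"
  shows "word_identity u v"
  using assms
proof cases
  case (1 a c p q)
  show ?thesis
    unfolding word_identity_def
  proof (intro allI impI)
    fix \<theta> :: "'a \<Rightarrow> nat list" assume \<theta>: "range \<theta> \<subseteq> lists {1..2}"
    note lists = word_value_lists[OF \<theta>] literal_value_lists[OF \<theta>]
    show "(word_value \<theta> u, word_value \<theta> v) \<in> baxter_cong 2"
    proof (cases "2 \<in> set (word_value \<theta> p) \<and> 1 \<in> set (word_value \<theta> q)")
      case True
      then show ?thesis
        using baxter_cong_2_commute[OF lists(1)[of p] lists(1)[of q] _ _ lists(2)[of a] lists(2)[of c]]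
        by (simp add: 1)
    next
      case False
      then have "literal_value \<theta> a @ literal_value \<theta> c = literal_value \<theta> c @ literal_value \<theta> a"
        using balanced_values_commute[OF \<theta> 1(4)] balanced_values_commute[OF \<theta> 1(5)] by blast
      then have "word_value \<theta> u = word_value \<theta> v"
        unfolding 1 by simp
      then show ?thesis by (simp only: baxter_cong.refl lists)
    qed
  qed
qed

text \<open>Balance ignores the order within a context, so reversal merely interchanges the two
  contexts. This yields soundness of the reversed identities.\<close>

lemma exchange_rev: "exchange u v \<Longrightarrow> exchange (rev u) (rev v)"
proof (induction rule: exchange.induct)
  case (1 a c p q)
  then show ?case
    using exchange.intros[of c a "rev q" "rev p"] by (auto simp: balanced_def)
qed

section \<open>Invariants of word identities\<close>

text \<open>For \<open>c = bar a\<close> the first two cases take precedence, so that only one weight occurs.\<close>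

definition test_value ::
  "nat \<Rightarrow> nat \<Rightarrow> nat \<Rightarrow> 'x literal \<Rightarrow> 'x literal \<Rightarrow> 'x literal \<Rightarrow> nat list" where
  "test_value i j m a c l =
    (if l = a then replicate m i else if l = bar a then replicate m j
     else if l = c then [j] else if l = bar c then [i] else [])"

text \<open>A literal and its bar receive powers of \<open>i\<close> and \<open>j\<close> of equal
  length, which the involution interchanges. Hence the values on unstarred letters determine all
  others consistently.\<close>

lemma test_value_realizable:
  assumes "{i, j} = {1, 2}" "i \<noteq> j"
  shows "range (\<lambda>z. test_value i j m a c (z, False)) \<subseteq> lists {1..2}"
    and "literal_value (\<lambda>z. test_value i j m a c (z, False)) = test_value i j m a c"
proof -
  have ij: "i = 1 \<and> j = 2 \<or> i = 2 \<and> j = 1"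
    using assms by (auto simp: doubleton_eq_iff)
  then show "range (\<lambda>z. test_value i j m a c (z, False)) \<subseteq> lists {1..2}"
    by (auto simp: test_value_def)
  show "literal_value (\<lambda>z. test_value i j m a c (z, False)) = test_value i j m a c"
  proof
    fix l
    show "literal_value (\<lambda>z. test_value i j m a c (z, False)) l = test_value i j m a c l"
      using ij
      by (cases l; cases a; cases c) (auto simp: literal_value_def test_value_def sharp_word_def)
  qed
qed

text \<open>The first \<open>bar a\<close> or \<open>c\<close> contributes a \<open>j\<close> and
  ends the block; before it each \<open>a\<close> contributes \<open>m\<close> letters and each
  \<open>bar c\<close> one. The filter excludes \<open>a\<close> so that nothing is counted twice
  when \<open>bar c = a\<close>.\<close>

lemma leading_test_value:
  assumes "i \<noteq> j" "0 < m" "a \<noteq> c"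
  shows "length (takeWhile (\<lambda>k. k = i) (concat (map (test_value i j m a c) u))) =
    m * count_list (takeWhile (\<lambda>l. l \<noteq> bar a \<and> l \<noteq> c) u) a +
    length (filter (\<lambda>l. l = bar c \<and> l \<noteq> a) (takeWhile (\<lambda>l. l \<noteq> bar a \<and> l \<noteq> c) u))"
proof (induction u)
  case (Cons l u)
  show ?case
  proof (cases "l = bar a \<or> l = c")
    case True
    then have "\<exists>w. test_value i j m a c l = j # w"
      using assms(2,3) by (cases m) (auto simp: test_value_def)
    with True \<open>i \<noteq> j\<close> show ?thesis by auto
  next
    case False
    then have "test_value i j m a c l = replicate (if l = a then m else if l = bar c then 1 else 0) i"
      by (simp add: test_value_def)
    with False Cons.IH show ?thesis
      by (simp add: takeWhile_replicate length_takeWhile_append)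
  qed
qed simp

lemma rev_concat_test_value:
  "rev (concat (map (test_value i j m a c) u)) = concat (map (test_value i j m a c) (rev u))"
proof -
  have "rev (test_value i j m a c l) = test_value i j m a c l" for l
    by (simp add: test_value_def)
  then show ?thesis by (induction u) auto
qed

lemma word_identity_test_value:
  assumes "word_identity u v" "{i, j} = {1, 2}" "i \<noteq> j"
  shows "(concat (map (test_value i j m a c) u), concat (map (test_value i j m a c) v))
    \<in> baxter_cong 2"
  using assms(1)[unfolded word_identity_def, rule_format, OF test_value_realizable(1)[OF assms(2,3)], of m a c]
  by (simp only: word_value_def test_value_realizable(2)[OF assms(2,3)])

text \<open>For \<open>c = bar a\<close> and \<open>m = 1\<close> only the occurrences of
  \<open>a\<close> produce the letter 1, one each.\<close>

lemma word_identity_count: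
  assumes "word_identity u v"
  shows "count_list u a = count_list v a"
proof -
  have "count_list (concat (map (test_value 1 2 1 a (bar a)) u)) 1 = count_list u a" for u
    by (induction u) (auto simp: test_value_def)
  with baxter_cong_count[OF word_identity_test_value[OF assms, of 1 2 1 a "bar a"], of 1]
  show ?thesis by simp
qed

text \<open>The number of leading 1s is linear in the weight \<open>m\<close>, and the required
  count is its slope. Comparing \<open>m = 1\<close> with \<open>m = 2\<close> isolates it.\<close>

lemma word_identity_leading:
  assumes "word_identity u v" "a \<noteq> c"
  shows "count_list (takeWhile (\<lambda>l. l \<noteq> bar a \<and> l \<noteq> c) u) a =
    count_list (takeWhile (\<lambda>l. l \<noteq> bar a \<and> l \<noteq> c) v) a"
proof -
  have "length (takeWhile (\<lambda>k. k = 1) (concat (map (test_value 1 2 m a c) u))) =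
      length (takeWhile (\<lambda>k. k = 1) (concat (map (test_value 1 2 m a c) v)))" for m
    by (rule baxter_cong_2_leading[OF word_identity_test_value[OF assms(1)]]) auto
  from this[of 1] this[of 2] show ?thesis
    by (simp add: leading_test_value assms(2))
qed

text \<open>The mirror image with \<open>i = 2\<close> and \<open>j = 1\<close>: test values are
  palindromes, so reversing the value amounts to reversing the word.\<close>

lemma word_identity_trailing:
  assumes "word_identity u v" "a \<noteq> c"
  shows "count_list (takeWhile (\<lambda>l. l \<noteq> bar a \<and> l \<noteq> c) (rev u)) a =
    count_list (takeWhile (\<lambda>l. l \<noteq> bar a \<and> l \<noteq> c) (rev v)) a"
proof -
  have "length (takeWhile (\<lambda>k. k = 2) (rev (concat (map (test_value 2 1 m a c) u)))) =
      length (takeWhile (\<lambda>k. k = 2) (rev (concat (map (test_value 2 1 m a c) v))))" for m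
    by (rule baxter_cong_2_trailing[OF word_identity_test_value[OF assms(1)]]) auto
  from this[of 1] this[of 2] show ?thesis
    by (simp add: rev_concat_test_value leading_test_value assms(2))
qed

lemma count_list_takeWhile_le: "count_list (takeWhile P u) a \<le> count_list u a"
  by (induction u) auto

section \<open>Sorting by exchanges\<close>

text \<open>The key step of the sorting: \<open>a\<close> is the next literal wanted after the
  common prefix \<open>w\<close>, and \<open>c\<close> stands directly before its first occurrence
  in the rest of the other word. Each half of a balance condition that failed would make a leading
  or trailing count differ.\<close>

lemma word_identity_exchangeable:
  assumes id: "word_identity (w @ a # u) (w @ B @ c # a # Q)" and "a \<notin> set B" "a \<noteq> c"
  shows "balanced c a (w @ B)" and "balanced c a Q"
proof -
  let ?U = "w @ a # u" and ?V = "w @ B @ c # a # Q"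
  have B: "count_list B a = 0" using assms(2) by (simp add: count_list_0_iff)
  have count: "count_list ?U l = count_list ?V l" for l
    by (rule word_identity_count[OF id])
  have count_a: "count_list u a = count_list Q a"
    using count[of a] B \<open>a \<noteq> c\<close> by simp
  have count_c: "count_list u c = Suc (count_list B c + count_list Q c)"
    using count[of c] \<open>a \<noteq> c\<close> by simp
  \<comment> \<open>Otherwise the leading count of \<open>a\<close>, stopped by \<open>bar a\<close>
    or \<open>c\<close>, includes the \<open>a\<close> after \<open>w\<close> on the left but ends
    at the displayed \<open>c\<close> on the right, where \<open>B\<close> adds no
    \<open>a\<close>.\<close>
  have p1: "c \<in> set (w @ B) \<or> bar a \<in> set (w @ B)"
  proof (rule ccontr)
    assume no: "\<not> ?thesis"
    let ?P = "\<lambda>l. l \<noteq> bar a \<and> l \<noteq> c"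
    have "\<forall>l\<in>set w. ?P l" "\<forall>l\<in>set B. ?P l" using no by auto
    then have "count_list (takeWhile ?P ?U) a = Suc (count_list w a + count_list (takeWhile ?P u) a)"
      "count_list (takeWhile ?P ?V) a = count_list w a"
      using \<open>a \<noteq> c\<close> B by (simp_all add: takeWhile_append2)
    then show False using word_identity_leading[OF id \<open>a \<noteq> c\<close>] by simp
  qed
  \<comment> \<open>Otherwise the leading count of \<open>c\<close>, stopped by \<open>bar c\<close>
    or \<open>a\<close>, ends right after \<open>w\<close> on the left but includes the displayed
    \<open>c\<close> on the right.\<close>
  have p2: "a \<in> set (w @ B) \<or> bar c \<in> set (w @ B)"
  proof (rule ccontr)
    assume no: "\<not> ?thesis"
    let ?P = "\<lambda>l. l \<noteq> bar c \<and> l \<noteq> a"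
    have "\<forall>l\<in>set w. ?P l" "\<forall>l\<in>set B. ?P l" using no by auto
    then have "count_list (takeWhile ?P ?U) c = count_list w c"
      "count_list (takeWhile ?P ?V) c \<ge> Suc (count_list w c)"
      using \<open>a \<noteq> c\<close> by (simp_all add: takeWhile_append2)
    then show False using word_identity_leading[OF id \<open>a \<noteq> c\<close>[symmetric]] by simp
  qed
  show "balanced c a (w @ B)"
    using p1 p2 by (auto simp: balanced_def)
  \<comment> \<open>Otherwise the trailing count of \<open>c\<close>, stopped by
    \<open>bar c\<close> or \<open>a\<close>, is that of \<open>Q\<close> on the right. On the left
    \<open>u\<close> contains no \<open>a\<close>, so only a \<open>bar c\<close> in
    \<open>u\<close> could stop the count before the end of \<open>u\<close>.\<close>
  have q1: "a \<in> set Q \<or> bar c \<in> set Q"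
  proof (rule ccontr)
    assume no: "\<not> ?thesis"
    let ?P = "\<lambda>l. l \<noteq> bar c \<and> l \<noteq> a" and ?P' = "\<lambda>l. l \<noteq> bar c"
    have Q: "\<forall>l\<in>set (rev Q). ?P l" "\<forall>l\<in>set (rev Q). ?P' l" using no by auto
    have "a \<notin> set u" using count_a no by (simp add: count_list_0_iff)
    have V: "count_list (takeWhile ?P (rev ?V)) c = count_list Q c"
      using Q(1) by (simp add: takeWhile_append count_list_rev)
    have trail: "count_list (takeWhile ?P (rev ?U)) c = count_list Q c"
      using word_identity_trailing[OF id \<open>a \<noteq> c\<close>[symmetric]] V by simp
    show False
    proof (cases "bar c \<in> set u")
      \<comment> \<open>The stop now lies inside \<open>u\<close>, where \<open>a\<close> does not
        occur, so dropping \<open>a\<close> as a stopping literal changes nothing on the left. On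
        the right the count then runs past \<open>a\<close> and gains the displayed
        \<open>c\<close>. This uses the invariant for the pair \<open>c\<close>,
        \<open>bar c\<close>.\<close>
      case True
      have "takeWhile ?P (rev ?U) = takeWhile ?P (rev u)"
        using True by (simp add: takeWhile_append1)
      also have "\<dots> = takeWhile ?P' (rev u)"
        using \<open>a \<notin> set u\<close> by (intro takeWhile_cong) auto
      also have "\<dots> = takeWhile ?P' (rev ?U)"
        using True by (simp add: takeWhile_append1)
      finally have "count_list (takeWhile ?P' (rev ?U)) c = count_list Q c"
        using trail by simp
      moreover have "count_list (takeWhile ?P' (rev ?V)) c > count_list Q c"
      proof (cases "a = bar c")
        case True
        with no \<open>bar c \<in> set u\<close> \<open>a \<notin> set u\<close> show ?thesis by simp
      next
        case False
        then show ?thesis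
          using Q(2) by (simp add: takeWhile_append count_list_rev)
      qed
      ultimately show False
        using word_identity_trailing[OF id bar_neq(2)[of c]] by simp
    next
      case False
      then have "\<forall>l\<in>set (rev u). ?P l" using \<open>a \<notin> set u\<close> by auto
      then have "count_list (takeWhile ?P (rev ?U)) c = count_list u c"
        by (simp add: takeWhile_append count_list_rev)
      with trail count_c show False by simp
    qed
  qed
  \<comment> \<open>Otherwise the trailing count of \<open>a\<close>, stopped by
    \<open>bar a\<close> or \<open>c\<close>, covers all of \<open>Q\<close> and one more
    \<open>a\<close> on the right. On the left it stops at a \<open>c\<close> inside
    \<open>u\<close>, which has only as many \<open>a\<close> as \<open>Q\<close>.\<close>
  have q2: "c \<in> set Q \<or> bar a \<in> set Q"
  proof (rule ccontr)
    assume no: "\<not> ?thesis"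
    let ?P = "\<lambda>l. l \<noteq> bar a \<and> l \<noteq> c"
    have "\<forall>l\<in>set (rev Q). ?P l" using no by auto
    then have "count_list (takeWhile ?P (rev ?V)) a = Suc (count_list Q a)"
      using \<open>a \<noteq> c\<close> by (simp add: takeWhile_append count_list_rev)
    moreover have "c \<in> set u" using count_c by (metis count_notin Zero_not_Suc)
    then have "takeWhile ?P (rev ?U) = takeWhile ?P (rev u)"
      by (simp add: takeWhile_append1)
    then have "count_list (takeWhile ?P (rev ?U)) a \<le> count_list Q a"
      using count_list_takeWhile_le[of ?P "rev u" a] count_a by (simp add: count_list_rev)
    ultimately show False using word_identity_trailing[OF id \<open>a \<noteq> c\<close>] by simp
  qed
  show "balanced c a Q"
    using q1 q2 by (auto simp: balanced_def)
qed

lemma word_identity_trans: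
  assumes "word_identity u v" "word_identity v w"
  shows "word_identity u w"
  unfolding word_identity_def
proof (intro allI impI)
  fix \<theta> :: "'a \<Rightarrow> nat list" assume "range \<theta> \<subseteq> lists {1..2}"
  note this [THEN assms(1)[unfolded word_identity_def, rule_format]]
    this [THEN assms(2)[unfolded word_identity_def, rule_format]]
  then show "(word_value \<theta> u, word_value \<theta> w) \<in> baxter_cong 2"
    by (rule baxter_cong.trans)
qed

lemma exchanges_word_identity: "exchange\<^sup>*\<^sup>* u v \<Longrightarrow> word_identity u v"
proof (induction rule: rtranclp_induct)
  case base
  show ?case
    unfolding word_identity_def by (intro allI impI baxter_cong.refl word_value_lists)
next
  case (step v w)
  from step.IH exchange_word_identity[OF step.hyps(2)] show ?case by (rule word_identity_trans)
qed

text \<open>Each exchange preserves the identity, so the hypothesis is available again after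
  \<open>a\<close> has passed the last literal of \<open>B\<close>, which then joins
  \<open>Q\<close>.\<close>

lemma word_identity_bubble:
  assumes "word_identity (w @ a # u) (w @ B @ a # Q)" "a \<notin> set B"
  shows "exchange\<^sup>*\<^sup>* (w @ B @ a # Q) (w @ a # B @ Q)"
  using assms
proof (induction B arbitrary: Q rule: rev_induct)
  case (snoc c B)
  have id: "word_identity (w @ a # u) (w @ B @ c # a # Q)" and a: "a \<notin> set B" "a \<noteq> c"
    using snoc.prems by auto
  from word_identity_exchangeable[OF this] a
  have "exchange ((w @ B) @ [c, a] @ Q) ((w @ B) @ [a, c] @ Q)"
    by (intro exchange.intros) auto
  then have step: "exchange (w @ B @ c # a # Q) (w @ B @ a # c # Q)" by simp
  have "exchange\<^sup>*\<^sup>* (w @ B @ a # c # Q) (w @ a # B @ c # Q)"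
    using word_identity_trans[OF id exchange_word_identity[OF step]] a(1) by (rule snoc.IH)
  with step show ?case by (simp add: converse_rtranclp_into_rtranclp)
qed simp

text \<open>The first occurrence of the head of \<open>u\<close> is moved to the front of
  \<open>v\<close> and then joins \<open>w\<close>. The common prefix is kept, not cancelled,
  because its literals may serve as context for later exchanges.\<close>

lemma word_identity_exchanges_prefix:
  assumes "word_identity (w @ u) (w @ v)"
  shows "exchange\<^sup>*\<^sup>* (w @ v) (w @ u)"
  using assms
proof (induction u arbitrary: w v)
  case Nil
  have "count_list v l = 0" for l
    using word_identity_count[OF Nil, of l] by simp
  then have "v = []" by (metis count_list_0_iff list.set_intros(1) neq_Nil_conv)
  then show ?case by simp
next
  case (Cons a u)
  have "count_list v a = Suc (count_list u a)"
    using word_identity_count[OF Cons.prems, of a] by simp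
  then have "a \<in> set v" by (metis count_notin Zero_not_Suc)
  then obtain B Q where v: "v = B @ a # Q" "a \<notin> set B"
    by (metis split_list_first)
  have bubble: "exchange\<^sup>*\<^sup>* (w @ v) (w @ a # B @ Q)"
    using Cons.prems v unfolding v(1) by (intro word_identity_bubble) auto
  have "word_identity ((w @ [a]) @ u) ((w @ [a]) @ B @ Q)"
    using word_identity_trans[OF Cons.prems exchanges_word_identity[OF bubble]] by simp
  from Cons.IH[OF this] bubble show ?case by simp
qed

lemma word_identity_exchanges: "word_identity u v \<Longrightarrow> exchange\<^sup>*\<^sup>* v u"
  using word_identity_exchanges_prefix[of "[]"] by simp

section \<open>Deductions\<close>

lemma directly_deducible_deducible:
  assumes "(p, q) \<in> \<Sigma>"
  shows "deducible \<Sigma> (subst_trm \<phi> p) (subst_trm \<phi> q)"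
  using assms directly_deducible.inst[of p q \<phi>] unfolding deducible_def by blast

lemma deducible_refl [simp]: "deducible \<Sigma> u u"
  by (simp add: deducible_def)

lemma deducible_trans: "deducible \<Sigma> u v \<Longrightarrow> deducible \<Sigma> v w \<Longrightarrow> deducible \<Sigma> u w"
  by (simp add: deducible_def)

lemma directly_deducible_sym: "directly_deducible p q u v \<Longrightarrow> directly_deducible q p v u"
proof (induction rule: directly_deducible.induct)
  case (inst \<phi>)
  show ?case by (rule directly_deducible.inst)
next
  case (left s t u)
  from left.IH show ?case by (rule directly_deducible.left)
next
  case (right s t u)
  from right.IH show ?case by (rule directly_deducible.right)
next
  case (star s t)
  from star.IH show ?case by (rule directly_deducible.star)
qed

lemma deducible_sym:
  assumes "deducible \<Sigma> u v"
  shows "deducible \<Sigma> v u"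
proof -
  have "symp (\<lambda>s t. \<exists>(p, q)\<in>\<Sigma>. directly_deducible p q s t \<or> directly_deducible q p s t)"
  proof (rule sympI)
    fix s t assume "\<exists>(p, q)\<in>\<Sigma>. directly_deducible p q s t \<or> directly_deducible q p s t"
    then obtain p q where pq: "(p, q) \<in> \<Sigma>" "directly_deducible p q s t \<or> directly_deducible q p s t"
      by blast
    from pq(2) have "directly_deducible p q t s \<or> directly_deducible q p t s"
      by (elim disjE) (simp_all only: directly_deducible_sym simp_thms)
    with pq(1) show "\<exists>(p, q)\<in>\<Sigma>. directly_deducible p q t s \<or> directly_deducible q p t s"
      by blast
  qed
  from sympD[OF symp_rtranclp[OF this]] assms show ?thesis
    unfolding deducible_def by blast
qed

lemma deducible_map:
  assumes "deducible \<Sigma> u v"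
    and "\<And>p q u v. directly_deducible p q u v \<Longrightarrow> directly_deducible p q (f u) (f v)"
  shows "deducible \<Sigma> (f u) (f v)"
  using assms(1) unfolding deducible_def
proof (induction rule: rtranclp_induct)
  case (step v w)
  from step.hyps(2) obtain p q where pq: "(p, q) \<in> \<Sigma>"
    "directly_deducible p q v w \<or> directly_deducible q p v w"
    by blast
  from pq(2) have "directly_deducible p q (f v) (f w) \<or> directly_deducible q p (f v) (f w)"
    by (elim disjE) (simp_all only: assms(2) simp_thms)
  with pq(1) have "\<exists>(p, q)\<in>\<Sigma>. directly_deducible p q (f v) (f w) \<or> directly_deducible q p (f v) (f w)"
    by blast
  with step.IH show ?case by (rule rtranclp.rtrancl_into_rtrancl)
qed simp

lemma deducible_star: "deducible \<Sigma> u v \<Longrightarrow> deducible \<Sigma> (star u) (star v)"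
  using deducible_map[of \<Sigma> u v star] directly_deducible.star by blast

lemma deducible_append:
  assumes "deducible \<Sigma> u u'" "deducible \<Sigma> v v'"
  shows "deducible \<Sigma> (u @ v) (u' @ v')"
proof (rule deducible_trans)
  show "deducible \<Sigma> (u @ v) (u' @ v)"
    by (rule deducible_map[OF assms(1)]) (rule directly_deducible.right)
  show "deducible \<Sigma> (u' @ v) (u' @ v')"
    by (rule deducible_map[OF assms(2)]) (rule directly_deducible.left)
qed

section \<open>Reduction of terms to words by the involution identities\<close>

lemma deducible_star_star:
  assumes "involution_identities x y \<subseteq> \<Sigma>"
  shows "deducible \<Sigma> (star (star u)) u"
proof -
  have "(star (star [Var x]), [Var x]) \<in> \<Sigma>"
    using assms by (auto simp: involution_identities_def)
  from directly_deducible_deducible[OF this, of "\<lambda>_. u"] show ?thesis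
    by (simp only: subst_trm_simps)
qed

lemma deducible_star_append:
  assumes "involution_identities x y \<subseteq> \<Sigma>" "x \<noteq> y"
  shows "deducible \<Sigma> (star (u @ v)) (star v @ star u)"
proof -
  have "(star ([Var x] @ [Var y]), star [Var y] @ star [Var x]) \<in> \<Sigma>"
    using assms by (auto simp: involution_identities_def)
  from directly_deducible_deducible[OF this, of "\<lambda>z. if z = y then v else u"] show ?thesis
    by (simp only: subst_trm_simps assms(2) if_True if_False simp_thms)
qed

lemma deducible_star_literal:
  assumes "involution_identities x y \<subseteq> \<Sigma>"
  shows "deducible \<Sigma> (star (word_trm [l])) (word_trm [bar l])"
proof (cases l rule: literal_factor.cases)
  case (1 z)
  then show ?thesis by simp
next
  case (2 z)
  then show ?thesis using deducible_star_star[OF assms, of "[Var z]"] by simp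
qed

text \<open>In the star case the argument is first rewritten to a word; its star is then distributed
  literal by literal, and the star of each literal reduces to its bar.\<close>

lemma deducible_norm_trm:
  assumes "involution_identities x y \<subseteq> \<Sigma>" "x \<noteq> y"
  shows "deducible \<Sigma> u (word_trm (norm_trm u))"
proof (induction u rule: trm_induct)
  case (Concat u v)
  then show ?case by (simp add: deducible_append)
next
  case (Star u)
  have "deducible \<Sigma> (star (word_trm w)) (word_trm (map bar (rev w)))" for w
  proof (induction w)
    case (Cons l w)
    have "deducible \<Sigma> (star (word_trm ([l] @ w))) (star (word_trm w) @ star (word_trm [l]))"
      unfolding map_append by (rule deducible_star_append[OF assms])
    moreover have "deducible \<Sigma> (star (word_trm w) @ star (word_trm [l]))
        (word_trm (map bar (rev w)) @ word_trm [bar l])"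
      by (rule deducible_append[OF Cons.IH deducible_star_literal[OF assms(1)]])
    ultimately show ?case by (auto intro: deducible_trans)
  qed simp
  with deducible_star[OF Star] show ?case
    by (auto intro: deducible_trans)
qed simp_all

section \<open>Deduction of exchanges from the listed word identities\<close>

text \<open>The literals of the word identities that are neither \<open>h\<close>, \<open>k\<close>, \<open>s\<close>, \<open>t\<close> nor part of
  the exchanged factor \<open>xy\<close>, in their order. The arguments stand for \<open>x\<close>, \<open>x\<^sup>*\<close>, \<open>y\<close>, \<open>y\<^sup>*\<close>.\<close>

definition contexts :: "'a \<Rightarrow> 'a \<Rightarrow> 'a \<Rightarrow> 'a \<Rightarrow> ('a \<times> 'a \<times> 'a \<times> 'a) set" where
  "contexts a a' c c' =
    {(a', a, a', a), (a', a, a, a'), (a, a', a', a), (a, a', a, a'),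
     (a', a, c', c), (a', a, c, c'), (a, a', c', c), (a, a', c, c'),
     (a, c, a, c), (a, c, c, a), (a, c, a', c'), (a, c, c', a'),
     (a', c', a', c'), (a', c', c', a'), (a', a, a, c), (a', a, c, a),
     (a, a', a, c), (a, a', c, a), (a', a, a', c'), (a', a, c', a'),
     (a, a', a', c'), (a, a', c', a')}"

text \<open>There are 64 choices of two literals on each side. Interchanging the roles of x and y
  and reversing the word brings each of them to one of the 22 listed contexts.\<close>

lemma contexts_complete:
  assumes "e1 \<in> {a, c'} \<and> e2 \<in> {a', c} \<or> e1 \<in> {a', c} \<and> e2 \<in> {a, c'}"
    and "f1 \<in> {a, c'} \<and> f2 \<in> {a', c} \<or> f1 \<in> {a', c} \<and> f2 \<in> {a, c'}"
  shows "(e1, e2, f1, f2) \<in> contexts a a' c c' \<or> (e1, e2, f1, f2) \<in> contexts c c' a a' \<or>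
    (f2, f1, e2, e1) \<in> contexts a a' c c' \<or> (f2, f1, e2, e1) \<in> contexts c c' a a'"
  using assms unfolding contexts_def by (elim disjE conjE insertE emptyE) simp_all

text \<open>Transfers a quadruple of literals to the identity of which it is an instance. A relation
  takes the place of a map because the image of \<open>x\<^sup>*\<close> under a substitution equals
  the intended literal only up to deduction.\<close>

lemma contexts_rel:
  assumes "(e1, e2, f1, f2) \<in> contexts a a' c c'" "r a b" "r a' b'" "r c d" "r c' d'"
  shows "\<exists>e1' e2' f1' f2'. (e1', e2', f1', f2') \<in> contexts b b' d d' \<and>
    r e1 e1' \<and> r e2 e2' \<and> r f1 f1' \<and> r f2 f2'"
proof -
  have "\<forall>(e1, e2, f1, f2)\<in>contexts a a' c c'. \<exists>(e1', e2', f1', f2')\<in>contexts b b' d d'.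
      r e1 e1' \<and> r e2 e2' \<and> r f1 f1' \<and> r f2 f2'"
    unfolding contexts_def using assms(2-) by simp
  with assms(1) show ?thesis by fastforce
qed

definition context_identity ::
  "'x \<Rightarrow> 'x \<Rightarrow> 'x \<Rightarrow> 'x \<Rightarrow> 'x \<Rightarrow> 'x \<Rightarrow> 'x literal \<times> 'x literal \<times> 'x literal \<times> 'x literal \<Rightarrow> 'x identity" where
  "context_identity x y h k s t = (\<lambda>(e1, e2, f1, f2).
    (word_trm [e1, (h, False), e2, (k, False), (x, False), (y, False), (s, False), f1, (t, False), f2],
     word_trm [e1, (h, False), e2, (k, False), (y, False), (x, False), (s, False), f1, (t, False), f2]))"

lemma baxt2_word_identities_eq:
  "baxt2_word_identities x y h k s t =
    context_identity x y h k s t ` contexts (x, False) (x, True) (y, False) (y, True)"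
  unfolding baxt2_word_identities_def contexts_def context_identity_def Let_def by simp

text \<open>Soundness of the listed identities: in every listed context the literals on either side
  of xy form a balanced block.\<close>

lemma baxt2_word_identity_exchange:
  assumes "x \<noteq> y" "e \<in> baxt2_word_identities x y h k s t"
  obtains u v where "e = (word_trm u, word_trm v)" "exchange u v" "u \<noteq> []" "v \<noteq> []"
proof -
  obtain e1 e2 f1 f2 where e: "e = context_identity x y h k s t (e1, e2, f1, f2)"
    and c: "(e1, e2, f1, f2) \<in> contexts (x, False) (x, True) (y, False) (y, True)"
    using assms(2) unfolding baxt2_word_identities_eq by (metis (no_types, lifting) imageE prod_cases4)
  let ?p = "[e1, (h, False), e2, (k, False)]" and ?q = "[(s, False), f1, (t, False), f2]"
  have "balanced (x, False) (y, False) ?p" "balanced (x, False) (y, False) ?q"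
    using c unfolding contexts_def balanced_def by (elim insertE emptyE; simp)+
  then have "exchange (?p @ [(x, False), (y, False)] @ ?q) (?p @ [(y, False), (x, False)] @ ?q)"
    using assms(1) by (intro exchange.intros) auto
  then show thesis
    by (intro that) (auto simp: e context_identity_def)
qed

text \<open>The literals \<open>a\<close>, \<open>c\<close> are substituted for \<open>x\<close>,
  \<open>y\<close> and the blocks for \<open>h\<close>, \<open>k\<close>, \<open>s\<close>,
  \<open>t\<close>. The resulting instance is then corrected on both sides by reducing stars of
  literals; the second claim starts from the reversed identity.\<close>

lemma deducible_contexts_words:
  assumes inv: "involution_identities x y \<subseteq> \<Sigma>" and dist: "distinct [x, y, h, k, s, t]"
    and \<Sigma>: "baxt2_word_identities x y h k s t \<subseteq> \<Sigma>"
      "reverse_identity ` baxt2_word_identities x y h k s t \<subseteq> \<Sigma>"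
    and e: "(e1, e2, f1, f2) \<in> contexts a (bar a) c (bar c)"
  shows "deducible \<Sigma> (word_trm ([e1] @ H @ [e2] @ K @ [a, c] @ S @ [f1] @ T @ [f2]))
      (word_trm ([e1] @ H @ [e2] @ K @ [c, a] @ S @ [f1] @ T @ [f2]))" (is ?direct)
    and "deducible \<Sigma> (word_trm ([f2] @ T @ [f1] @ S @ [c, a] @ K @ [e2] @ H @ [e1]))
      (word_trm ([f2] @ T @ [f1] @ S @ [a, c] @ K @ [e2] @ H @ [e1]))" (is ?reverse)
proof -
  define \<phi> where "\<phi> z =
    (if z = x then word_trm [a] else if z = y then word_trm [c] else if z = h then word_trm H
     else if z = k then word_trm K else if z = s then word_trm S else word_trm T)" for z
  have \<phi>: "\<phi> x = word_trm [a]" "\<phi> y = word_trm [c]" "\<phi> h = word_trm H" "\<phi> k = word_trm K"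
    "\<phi> s = word_trm S" "\<phi> t = word_trm T"
    using dist by (auto simp: \<phi>_def)
  \<comment> \<open>\<open>r l l'\<close> means that the image of the identity letter
    \<open>l'\<close> can be rewritten to the literal \<open>l\<close>.\<close>
  define r where "r l l' \<longleftrightarrow> deducible \<Sigma> (subst_factor \<phi> (literal_factor l')) (word_trm [l])" for l l'
  have "r a (x, False)" "r (bar a) (x, True)" "r c (y, False)" "r (bar c) (y, True)"
    using deducible_star_literal[OF inv] by (simp_all add: r_def \<phi>)
  from contexts_rel[of _ _ _ _ _ _ _ _ r, OF e this] obtain e1' e2' f1' f2'
    where e': "(e1', e2', f1', f2') \<in> contexts (x, False) (x, True) (y, False) (y, True)"
      and r: "r e1 e1'" "r e2 e2'" "r f1 f1'" "r f2 f2'"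
    by blast
  have id: "context_identity x y h k s t (e1', e2', f1', f2') \<in> \<Sigma>"
    "reverse_identity (context_identity x y h k s t (e1', e2', f1', f2')) \<in> \<Sigma>"
    using \<Sigma> e' unfolding baxt2_word_identities_eq by blast+
  let ?g = "\<lambda>l. subst_factor \<phi> (literal_factor l)"
  have d: "deducible \<Sigma> (?g e1' @ word_trm H @ ?g e2' @ word_trm K @ z @ word_trm S @ ?g f1' @ word_trm T @ ?g f2')
      (word_trm [e1] @ word_trm H @ word_trm [e2] @ word_trm K @ z @ word_trm S @ word_trm [f1] @ word_trm T @ word_trm [f2])" for z
    using r unfolding r_def by (intro deducible_append) simp_all
  have d': "deducible \<Sigma> (?g f2' @ word_trm T @ ?g f1' @ word_trm S @ z @ word_trm K @ ?g e2' @ word_trm H @ ?g e1')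
      (word_trm [f2] @ word_trm T @ word_trm [f1] @ word_trm S @ z @ word_trm K @ word_trm [e2] @ word_trm H @ word_trm [e1])" for z
    using r unfolding r_def by (intro deducible_append) simp_all
  have "deducible \<Sigma>
      (?g e1' @ word_trm H @ ?g e2' @ word_trm K @ word_trm [a, c] @ word_trm S @ ?g f1' @ word_trm T @ ?g f2')
      (?g e1' @ word_trm H @ ?g e2' @ word_trm K @ word_trm [c, a] @ word_trm S @ ?g f1' @ word_trm T @ ?g f2')"
    using directly_deducible_deducible[OF id(1)[unfolded context_identity_def prod.case], of \<phi>]
    by (simp add: subst_trm_def \<phi>)
  from deducible_trans[OF deducible_sym[OF d] deducible_trans[OF this d]]
  show ?direct by simp
  have "deducible \<Sigma>
      (?g f2' @ word_trm T @ ?g f1' @ word_trm S @ word_trm [c, a] @ word_trm K @ ?g e2' @ word_trm H @ ?g e1')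
      (?g f2' @ word_trm T @ ?g f1' @ word_trm S @ word_trm [a, c] @ word_trm K @ ?g e2' @ word_trm H @ ?g e1')"
    using directly_deducible_deducible[OF id(2)[unfolded context_identity_def reverse_identity_def prod.case], of \<phi>]
    by (simp add: subst_trm_def \<phi>)
  from deducible_trans[OF deducible_sym[OF d'] deducible_trans[OF this d']]
  show ?reverse by simp
qed

lemma split_list_two:
  assumes "e \<in> set p" "f \<in> set p" "e \<noteq> f"
  obtains p1 p2 p3 where "p = p1 @ e # p2 @ f # p3 \<or> p = p1 @ f # p2 @ e # p3"
proof -
  obtain q1 q2 where p: "p = q1 @ e # q2" using split_list[OF assms(1)] by blast
  with assms have "f \<in> set q1 \<or> f \<in> set q2" by auto
  then show thesis
    using that p by (metis append.assoc append_Cons split_list)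
qed

text \<open>For \<open>a \<noteq> c\<close> the sets \<open>{a, bar c}\<close> and
  \<open>{bar a, c}\<close> are disjoint, so their witnesses occupy different positions. Either may
  come first.\<close>

lemma balanced_split:
  assumes "balanced a c p" "a \<noteq> c"
  obtains p1 e p2 f p3 where "p = p1 @ [e] @ p2 @ [f] @ p3"
    "e \<in> {a, bar c} \<and> f \<in> {bar a, c} \<or> e \<in> {bar a, c} \<and> f \<in> {a, bar c}"
proof -
  obtain e f where ef: "e \<in> {a, bar c}" "f \<in> {bar a, c}" "e \<in> set p" "f \<in> set p"
    using assms(1) unfolding balanced_def by blast
  moreover have "e \<noteq> f" using ef assms(2) by auto
  ultimately obtain p1 p2 p3 where "p = p1 @ e # p2 @ f # p3 \<or> p = p1 @ f # p2 @ e # p3"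
    using split_list_two[of e p f] by metis
  then show thesis
    using that[of p1 e p2 f p3] that[of p1 f p2 e p3] ef(1,2) by auto
qed

text \<open>The two witnesses of balance in each context become the four literals around
  \<open>h\<close>, \<open>k\<close>, \<open>s\<close>, \<open>t\<close>, for which the blocks
  between them, possibly empty, are substituted. The outer blocks \<open>p1\<close> and
  \<open>q3\<close> are added by congruence.\<close>

lemma exchange_deducible:
  assumes \<Sigma>: "involution_identities x y \<subseteq> \<Sigma>" "distinct [x, y, h, k, s, t]"
      "baxt2_word_identities x y h k s t \<subseteq> \<Sigma>"
      "reverse_identity ` baxt2_word_identities x y h k s t \<subseteq> \<Sigma>"
    and "exchange u v"
  shows "deducible \<Sigma> (word_trm u) (word_trm v)"
  using assms(5)
proof cases
  case (1 a c p q)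
  obtain p1 e1 p2 e2 p3 where p: "p = p1 @ [e1] @ p2 @ [e2] @ p3"
    "e1 \<in> {a, bar c} \<and> e2 \<in> {bar a, c} \<or> e1 \<in> {bar a, c} \<and> e2 \<in> {a, bar c}"
    using balanced_split[OF 1(4,3)] .
  obtain q1 f1 q2 f2 q3 where q: "q = q1 @ [f1] @ q2 @ [f2] @ q3"
    "f1 \<in> {a, bar c} \<and> f2 \<in> {bar a, c} \<or> f1 \<in> {bar a, c} \<and> f2 \<in> {a, bar c}"
    using balanced_split[OF 1(5,3)] .
  let ?w = "\<lambda>z. [e1] @ p2 @ [e2] @ p3 @ z @ q1 @ [f1] @ q2 @ [f2]"
  have "deducible \<Sigma> (word_trm (?w [a, c])) (word_trm (?w [c, a]))"
    \<comment> \<open>Interchanging \<open>a\<close> and \<open>c\<close> or reversing the word also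
      exchanges the two sides of the identity; symmetry of deduction restores the direction where
      needed.\<close>
    using contexts_complete[OF p(2) q(2)]
    by (elim disjE) (blast intro: deducible_contexts_words[OF \<Sigma>] deducible_sym)+
  then have "deducible \<Sigma> (word_trm p1 @ word_trm (?w [a, c]) @ word_trm q3)
      (word_trm p1 @ word_trm (?w [c, a]) @ word_trm q3)"
    by (intro deducible_append) simp_all
  then show ?thesis by (simp add: 1 p q)
qed

lemma exchanges_deducible:
  assumes "exchange\<^sup>*\<^sup>* u v" "\<And>u v. exchange u v \<Longrightarrow> deducible \<Sigma> (word_trm u) (word_trm v)"
  shows "deducible \<Sigma> (word_trm u) (word_trm v)"
  using assms(1) by (induction rule: rtranclp_induct) (auto intro: deducible_trans assms(2))

section \<open>Soundness and completeness of the basis\<close>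

lemma exchange_sound:
  assumes "exchange u v" "u \<noteq> []" "v \<noteq> []"
  shows "is_identity (word_trm u, word_trm v) \<and>
    satisfies (baxt 2) (schuetzenberger 2) (word_trm u, word_trm v)"
  using assms by (simp add: is_identity_def satisfies_baxt_iff exchange_word_identity)

theorem theorem5p1:
  fixes x y h k s t :: 'x
  assumes "countable (UNIV :: 'x set)" and "infinite (UNIV :: 'x set)"
    and "distinct [x, y, h, k, s, t]"
  shows "identity_basis (baxt 2) (schuetzenberger 2)
    (involution_identities x y
      \<union> baxt2_word_identities x y h k s t
      \<union> reverse_identity ` baxt2_word_identities x y h k s t)"
proof -
  let ?W = "baxt2_word_identities x y h k s t"
  let ?\<Sigma> = "involution_identities x y \<union> ?W \<union> reverse_identity ` ?W"
  have "x \<noteq> y" using assms(3) by simp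
  have inv: "involution_identities x y \<subseteq> ?\<Sigma>" and W: "?W \<subseteq> ?\<Sigma>" "reverse_identity ` ?W \<subseteq> ?\<Sigma>"
    by auto
  have "is_identity e \<and> satisfies (baxt 2) (schuetzenberger 2) e" if e: "e \<in> ?\<Sigma>" for e
  proof -
    consider "e \<in> involution_identities x y" | "e \<in> ?W" | e' where "e' \<in> ?W" "e = reverse_identity e'"
      using e by blast
    then show ?thesis
    proof cases
      case 1
      \<comment> \<open>Both sides of an involution identity have the same normal form, so
        reflexivity suffices.\<close>
      moreover have "word_identity w w" for w :: "'x literal list"
        by (rule exchanges_word_identity) simp
      ultimately show ?thesis
        by (auto simp: involution_identities_def is_identity_def satisfies_baxt_iff norm_trm_def)
    next
      case 2
      from baxt2_word_identity_exchange[OF \<open>x \<noteq> y\<close> this] show ?thesis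
        by (metis exchange_sound)
    next
      case 3
      obtain u v where "e' = (word_trm u, word_trm v)" "exchange u v" "u \<noteq> []" "v \<noteq> []"
        by (rule baxt2_word_identity_exchange[OF \<open>x \<noteq> y\<close> 3(1)])
      then show ?thesis
        using exchange_sound[OF exchange_rev[of u v]] by (simp add: 3 reverse_identity_def rev_map)
    qed
  qed
  moreover have "deducible ?\<Sigma> u v" if "satisfies (baxt 2) (schuetzenberger 2) (u, v)" for u v :: "'x trm"
  proof -
    have "exchange\<^sup>*\<^sup>* (norm_trm v) (norm_trm u)"
      using that by (simp add: satisfies_baxt_iff word_identity_exchanges)
    then have "deducible ?\<Sigma> (word_trm (norm_trm v)) (word_trm (norm_trm u))"
      by (rule exchanges_deducible[OF _ exchange_deducible[OF inv assms(3) W]])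
    \<comment> \<open>Both terms are joined to their normal forms by the involution identities, and
      the normal forms to each other by exchanges.\<close>
    then show ?thesis
      using deducible_norm_trm[OF inv \<open>x \<noteq> y\<close>] by (meson deducible_sym deducible_trans)
  qed
  ultimately show ?thesis
    unfolding identity_basis_def by blast
qed

end
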